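(* Let $(\underline P_\varepsilon,\overline P_\varepsilon)$ be an $\varepsilon$-contamination model on $\mathcal A(\mathbb P)$ with $0<\varepsilon<1$, built from a probability $P_0$. Let $\mathcal B\subset\mathcal A(\mathbb P)\setminus\{\emptyset\}$ be a partition and $A\in\mathcal A(\mathbb P)$ non-extreme and logically independent of $\mathcal B$. Suppose that $$P_0(A\wedge B)>0,\quad P_0(A^{\mathsf c}\wedge B)>0,\qquad \forall B\in\mathcal B.$$ Then $\mathcal B$ weakly dilates $A$ if and only if, for all $B\in\mathcal B$, $$-\varepsilon P_0(A^{\mathsf c})P_0(B^{\mathsf c})\le P_0(A\wedge B)-P_0(A)P_0(B)\le \varepsilon P_0(A)P_0(B^{\mathsf c}).$$
   Context: Let $\mathbb P$ be a partition (finite or infinite) of the sure event $\Omega$ and $\mathcal A(\mathbb P)$ the set of events logically dependent on $\mathbb P$, i.e. (identifying events with sets) the power set of $\mathbb P$, with $\Omega$ the whole set, $\emptyset$ the impossible event, $\wedge,{}^{\mathsf c}$ intersection and complement, and $A\Rightarrow B$ meaning $A\subseteq B$. A partition $\mathcal B\subset\mathcal A(\mathbb P)\setminus\{\emptyset\}$ is a family of pairwise disjoint non-empty events whose union is $\Omega$. "Probability" means finitely additive probability on $\mathcal A(\mathbb P)$. The $\varepsilon$-contamination model is given by $\underline P_\varepsilon(A)=(1-\varepsilon)P_0(A)$ for $A\ne\Omega$, $\underline P_\varepsilon(\Omega)=1$, and $\overline P_\varepsilon(A)=(1-\varepsilon)P_0(A)+\varepsilon$ for $A\ne\emptyset$,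 $\overline P_\varepsilon(\emptyset)=0$, where $P_0$ is a given probability. Natural extension: let $\mathcal M=\{P \text{ probability on }\mathcal A(\mathbb P): P\ge\underline P_\varepsilon\}$. For $B\ne\emptyset$, let $\mathcal M_B$ be the set of pairs $(P,P(\cdot|B))$ with $P\in\mathcal M$ and $P(\cdot|B)$ a probability on $\mathcal A(\mathbb P)$ satisfying $P(B|B)=1$ and $P(A\wedge B)=P(A|B)P(B)$ for all $A\in\mathcal A(\mathbb P)$. Then $\underline E(A|B)=\inf_{\mathcal M_B}P(A|B)$ and $\overline E(A|B)=\sup_{\mathcal M_B}P(A|B)$. $\mathcal B$ weakly dilates $A$ if $\underline E(A|B)\le\underline P_\varepsilon(A)\le\overline P_\varepsilon(A)\le\overline E(A|B)$ for all $B\in\mathcal B$. $A$ is logically independent of $\mathcal B$ if $B\not\Rightarrow A$ and $B\not\Rightarrow A^{\mathsf c}$ for all $B\in\mathcal B$. $A$ is extreme if its lower and upper probabilities are both $0$ or both $1$. *)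

theory Defs
  imports "HOL-Analysis.Measure_Space"
begin

text \<open>
  The partition (the set of atoms) is a set \<open>\<Omega>\<close>, finite or infinite, and the events logically
  dependent on it are identified with the elements of \<^term>\<open>Pow \<Omega>\<close>; the sure event is \<open>\<Omega>\<close>,
  the complement of \<open>A\<close> is \<^term>\<open>\<Omega> - A\<close>, and implication between events is inclusion.
  Uncertainty measures are total functions on sets, of which only the values on \<^term>\<open>Pow \<Omega>\<close>
  matter.
\<close>

definition fa_prob :: "'w set \<Rightarrow> ('w set \<Rightarrow> real) \<Rightarrow> bool" where
  "fa_prob \<Omega> P \<longleftrightarrow> (\<forall>A\<in>Pow \<Omega>. 0 \<le> P A) \<and> P \<Omega> = 1 \<and> additive (Pow \<Omega>) P"

definition contam_lower :: "'w set \<Rightarrow> real \<Rightarrow> ('w set \<Rightarrow> real) \<Rightarrow> 'w set \<Rightarrow> real" where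
  "contam_lower \<Omega> \<epsilon> P0 A = (if A = \<Omega> then 1 else (1 - \<epsilon>) * P0 A)"

definition contam_upper :: "real \<Rightarrow> ('w set \<Rightarrow> real) \<Rightarrow> 'w set \<Rightarrow> real" where
  "contam_upper \<epsilon> P0 A = (if A = {} then 0 else (1 - \<epsilon>) * P0 A + \<epsilon>)"

definition credal_set :: "'w set \<Rightarrow> ('w set \<Rightarrow> real) \<Rightarrow> ('w set \<Rightarrow> real) set" where
  "credal_set \<Omega> L = {P. fa_prob \<Omega> P \<and> (\<forall>A\<in>Pow \<Omega>. L A \<le> P A)}"

text \<open>
  In a pair \<open>(P, Q)\<close>, \<open>Q\<close> is a conditional probability given \<open>B\<close>. When \<open>P B = 0\<close> the product rule
  leaves \<open>Q\<close> unconstrained except for \<open>Q B = 1\<close>.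
\<close>

definition cond_credal_set ::
  "'w set \<Rightarrow> ('w set \<Rightarrow> real) \<Rightarrow> 'w set \<Rightarrow> (('w set \<Rightarrow> real) \<times> ('w set \<Rightarrow> real)) set" where
  "cond_credal_set \<Omega> L B =
     {(P, Q). P \<in> credal_set \<Omega> L \<and> fa_prob \<Omega> Q \<and> Q B = 1 \<and>
              (\<forall>A\<in>Pow \<Omega>. P (A \<inter> B) = Q A * P B)}"

definition lower_natural_ext ::
  "'w set \<Rightarrow> ('w set \<Rightarrow> real) \<Rightarrow> 'w set \<Rightarrow> 'w set \<Rightarrow> real" where
  "lower_natural_ext \<Omega> L A B = (INF (P, Q) \<in> cond_credal_set \<Omega> L B. Q A)"

definition upper_natural_ext ::
  "'w set \<Rightarrow> ('w set \<Rightarrow> real) \<Rightarrow> 'w set \<Rightarrow> 'w set \<Rightarrow> real" where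
  "upper_natural_ext \<Omega> L A B = (SUP (P, Q) \<in> cond_credal_set \<Omega> L B. Q A)"

definition weakly_dilates ::
  "'w set \<Rightarrow> ('w set \<Rightarrow> real) \<Rightarrow> ('w set \<Rightarrow> real) \<Rightarrow> 'w set set \<Rightarrow> 'w set \<Rightarrow> bool" where
  "weakly_dilates \<Omega> L U \<B> A \<longleftrightarrow>
     (\<forall>B\<in>\<B>. lower_natural_ext \<Omega> L A B \<le> L A \<and> L A \<le> U A \<and> U A \<le> upper_natural_ext \<Omega> L A B)"

definition logically_independent :: "'w set \<Rightarrow> 'w set \<Rightarrow> 'w set set \<Rightarrow> bool" where
  "logically_independent \<Omega> A \<B> \<longleftrightarrow> (\<forall>B\<in>\<B>. \<not> B \<subseteq> A \<and> \<not> B \<subseteq> \<Omega> - A)"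

definition extreme_event :: "('w set \<Rightarrow> real) \<Rightarrow> ('w set \<Rightarrow> real) \<Rightarrow> 'w set \<Rightarrow> bool" where
  "extreme_event L U A \<longleftrightarrow> (L A = 0 \<and> U A = 0) \<or> (L A = 1 \<and> U A = 1)"

end

theory Submission
  imports Defs
begin

text \<open>
  If \<open>P0 (A \<inter> B) > 0\<close>, every dominating \<open>P\<close> has \<open>P B > 0\<close>, so \<open>Q A = P (A \<inter> B) / P B\<close>. This ratio is
  smallest when the contaminating mass \<open>\<epsilon>\<close> sits entirely on one atom of \<open>B - A\<close>; hence
  \<open>E(A|B) = (1 - \<epsilon>) P0 (A \<inter> B) / ((1 - \<epsilon>) P0 B + \<epsilon>)\<close> for the lower extension, and the upper one
  follows by conjugacy. The inequalities that define weak dilation then clear denominators to the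
  stated ones, the upper bound for \<open>A\<close> being the lower bound for its complement.
\<close>

lemma fa_prob_nonneg: "fa_prob \<Omega> P \<Longrightarrow> X \<subseteq> \<Omega> \<Longrightarrow> 0 \<le> P X"
  by (simp add: fa_prob_def)

lemma fa_prob_Un:
  "fa_prob \<Omega> P \<Longrightarrow> X \<subseteq> \<Omega> \<Longrightarrow> Y \<subseteq> \<Omega> \<Longrightarrow> X \<inter> Y = {} \<Longrightarrow> P (X \<union> Y) = P X + P Y"
  by (simp add: fa_prob_def additive_def)

lemma fa_prob_compl:
  assumes "fa_prob \<Omega> P" "X \<subseteq> \<Omega>"
  shows "P (\<Omega> - X) = 1 - P X"
proof -
  have "X \<union> (\<Omega> - X) = \<Omega>" using assms(2) by blast
  then show ?thesis
    using fa_prob_Un[OF assms, of "\<Omega> - X"] assms(1) by (simp add: fa_prob_def)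
qed

lemma fa_prob_split:
  assumes "fa_prob \<Omega> P" "B \<subseteq> \<Omega>"
  shows "P B = P (A \<inter> B) + P (B - A)"
proof -
  have "(A \<inter> B) \<union> (B - A) = B" by blast
  moreover have "P ((A \<inter> B) \<union> (B - A)) = P (A \<inter> B) + P (B - A)"
    by (rule fa_prob_Un[OF assms(1)]) (use assms(2) in auto)
  ultimately show ?thesis by simp
qed

text \<open>The mixture of \<open>P0\<close> with the point mass at \<open>w\<close>; for a suitable
  \<open>w\<close> it is the extremal member of the credal set.\<close>

lemma fa_prob_contaminate_point:
  assumes "fa_prob \<Omega> P0" "0 \<le> \<epsilon>" "\<epsilon> \<le> 1" "w \<in> \<Omega>"
  shows "fa_prob \<Omega> (\<lambda>X. (1 - \<epsilon>) * P0 X + \<epsilon> * indicator X w)"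
proof -
  have "0 \<le> (1 - \<epsilon>) * P0 X + \<epsilon> * indicator X w" if "X \<subseteq> \<Omega>" for X
    using assms fa_prob_nonneg[OF assms(1) that] by simp
  then show ?thesis
    using assms by (auto simp: fa_prob_def additive_def indicator_def distrib_left)
qed

lemma fa_prob_conditional:
  assumes "fa_prob \<Omega> P" "B \<subseteq> \<Omega>" "0 < P B"
  shows "fa_prob \<Omega> (\<lambda>X. P (X \<inter> B) / P B)"
  unfolding fa_prob_def additive_def
proof (intro conjI ballI impI)
  fix X assume "X \<in> Pow \<Omega>"
  then show "0 \<le> P (X \<inter> B) / P B"
    using assms by (auto intro!: divide_nonneg_pos fa_prob_nonneg[OF assms(1)])
next
  show "P (\<Omega> \<inter> B) / P B = 1"
    using assms by (simp add: Int_absorb1)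
next
  fix X Y assume "X \<in> Pow \<Omega>" "Y \<in> Pow \<Omega>" "X \<inter> Y = {}"
  moreover have "(X \<union> Y) \<inter> B = (X \<inter> B) \<union> (Y \<inter> B)" by blast
  ultimately have "P ((X \<union> Y) \<inter> B) = P (X \<inter> B) + P (Y \<inter> B)"
    using fa_prob_Un[OF assms(1), of "X \<inter> B" "Y \<inter> B"] by auto
  then show "P ((X \<union> Y) \<inter> B) / P B = P (X \<inter> B) / P B + P (Y \<inter> B) / P B"
    by (simp add: add_divide_distrib)
qed

definition contam_cond_lower ::
  "real \<Rightarrow> ('w set \<Rightarrow> real) \<Rightarrow> 'w set \<Rightarrow> 'w set \<Rightarrow> real" where
  "contam_cond_lower \<epsilon> P0 A B = (1 - \<epsilon>) * P0 (A \<inter> B) / ((1 - \<epsilon>) * P0 B + \<epsilon>)"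

text \<open>Equality holds except possibly at \<open>\<Omega>\<close>, where the lower probability
  jumps up to 1. Dominance thus yields one linear bound for all events, with no case split on
  \<open>\<Omega>\<close>.\<close>

lemma contam_lower_ge:
  assumes "fa_prob \<Omega> P0" "0 \<le> \<epsilon>"
  shows "(1 - \<epsilon>) * P0 X \<le> contam_lower \<Omega> \<epsilon> P0 X"
  using assms by (simp add: contam_lower_def fa_prob_def)

text \<open>With \<open>a = P (A \<inter> B)\<close> and \<open>c = P (B - A)\<close>, the value
  \<open>Q A = a / (a + c)\<close> increases in \<open>a\<close> and decreases in \<open>c\<close>,
  so the least admissible \<open>a\<close> and the greatest admissible \<open>c\<close> together
  bound it from below.\<close>

lemma contam_cond_lower_le:
  assumes P0: "fa_prob \<Omega> P0" and eps: "0 < \<epsilon>" "\<epsilon> < 1"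
    and sub: "A \<subseteq> \<Omega>" "B \<subseteq> \<Omega>" and pos: "0 < P0 (A \<inter> B)"
    and PQ: "(P, Q) \<in> cond_credal_set \<Omega> (contam_lower \<Omega> \<epsilon> P0) B"
  shows "contam_cond_lower \<epsilon> P0 A B \<le> Q A"
proof -
  define a0 c0 a c where "a0 = P0 (A \<inter> B)" and "c0 = P0 (B - A)"
    and "a = P (A \<inter> B)" and "c = P (B - A)"
  have P: "fa_prob \<Omega> P" and dom: "\<And>X. X \<subseteq> \<Omega> \<Longrightarrow> (1 - \<epsilon>) * P0 X \<le> P X"
    and prod: "P (A \<inter> B) = Q A * P B"
    using PQ sub contam_lower_ge[OF P0, of \<epsilon>] eps
    by (fastforce simp: cond_credal_set_def credal_set_def intro: order_trans)+
  have split: "P B = a + c" "P0 B = a0 + c0"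
    using fa_prob_split[OF P sub(2), of A] fa_prob_split[OF P0 sub(2), of A]
    by (simp_all add: a_def c_def a0_def c0_def)
  have a0: "0 < a0" and c0: "0 \<le> c0" and c: "0 \<le> c"
    using pos sub by (auto simp: a0_def c0_def c_def
        intro!: fa_prob_nonneg[OF P0] fa_prob_nonneg[OF P])
  have a: "(1 - \<epsilon>) * a0 \<le> a"
    using dom[of "A \<inter> B"] sub by (auto simp: a_def a0_def)
  have BA: "B - A \<subseteq> \<Omega>" using sub by blast
  \<comment> \<open>The credal set is given by lower bounds only, so the upper bound on
    \<open>c\<close> comes from dominance at the complement of \<open>B - A\<close>.\<close>
  have "(1 - \<epsilon>) * (1 - c0) \<le> 1 - c"
    using dom[of "\<Omega> - (B - A)"] BA
      fa_prob_compl[OF P, of "B - A"] fa_prob_compl[OF P0, of "B - A"]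
    by (auto simp: c_def c0_def)
  then have c_le: "c \<le> (1 - \<epsilon>) * c0 + \<epsilon>"
    by (simp add: algebra_simps)
  have pos': "0 < (1 - \<epsilon>) * a0" using a0 eps by simp
  have "(1 - \<epsilon>) * a0 * c \<le> a * ((1 - \<epsilon>) * c0 + \<epsilon>)"
    by (rule mult_mono) (use a c_le pos' c in auto)
  \<comment> \<open>Adding \<open>(1 - \<epsilon>) * a0 * a\<close> to both sides turns the product
    bound into the cross-multiplied comparison of the two ratios.\<close>
  then have "(1 - \<epsilon>) * a0 * (a + c) \<le> a * ((1 - \<epsilon>) * (a0 + c0) + \<epsilon>)"
    by (simp add: algebra_simps)
  moreover have "0 < (1 - \<epsilon>) * (a0 + c0) + \<epsilon>"
    using a0 c0 eps by (simp add: add_nonneg_pos)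
  moreover have "0 < a + c" using a pos' c by linarith
  ultimately have "(1 - \<epsilon>) * a0 / ((1 - \<epsilon>) * (a0 + c0) + \<epsilon>) \<le> a / (a + c)"
    by (simp add: divide_le_eq le_divide_eq mult.commute)
  also have "a / (a + c) = Q A"
    using prod \<open>0 < a + c\<close> by (simp add: divide_eq_eq split flip: a_def)
  finally show ?thesis
    by (simp add: contam_cond_lower_def split flip: a0_def)
qed

text \<open>An atom \<open>w\<close> of \<open>B - A\<close> receives all the contaminating mass:
  this raises \<open>P B\<close> by \<open>\<epsilon>\<close> and adds nothing to
  \<open>P (A \<inter> B)\<close>.\<close>

lemma contam_cond_lower_attained:
  assumes P0: "fa_prob \<Omega> P0" and eps: "0 < \<epsilon>" "\<epsilon> < 1"
    and sub: "A \<subseteq> \<Omega>" "B \<subseteq> \<Omega>" and "\<not> B \<subseteq> A"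
  obtains P Q where "(P, Q) \<in> cond_credal_set \<Omega> (contam_lower \<Omega> \<epsilon> P0) B"
    and "Q A = contam_cond_lower \<epsilon> P0 A B"
proof -
  obtain w where w: "w \<in> B" "w \<notin> A" using \<open>\<not> B \<subseteq> A\<close> by blast
  define P where "P = (\<lambda>X. (1 - \<epsilon>) * P0 X + \<epsilon> * indicator X w)"
  define Q where "Q = (\<lambda>X. P (X \<inter> B) / P B)"
  have P: "fa_prob \<Omega> P"
    unfolding P_def by (rule fa_prob_contaminate_point) (use P0 eps w sub in auto)
  have PB: "P B = (1 - \<epsilon>) * P0 B + \<epsilon>" "P (A \<inter> B) = (1 - \<epsilon>) * P0 (A \<inter> B)"
    using w by (simp_all add: P_def)
  \<comment> \<open>The mass \<open>\<epsilon>\<close> at \<open>w\<close> alone makes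
    \<open>P B\<close> positive, so the quotient defining \<open>Q\<close> is a genuine conditional
    probability even if \<open>P0 B\<close> vanishes.\<close>
  have "0 < P B"
    using PB eps fa_prob_nonneg[OF P0 sub(2)] by (simp add: add_nonneg_pos)
  moreover have "contam_lower \<Omega> \<epsilon> P0 X \<le> P X" if "X \<subseteq> \<Omega>" for X
    using P eps by (auto simp: contam_lower_def fa_prob_def P_def)
  ultimately have "(P, Q) \<in> cond_credal_set \<Omega> (contam_lower \<Omega> \<epsilon> P0) B"
    using P fa_prob_conditional[OF P sub(2)]
    by (auto simp: cond_credal_set_def credal_set_def Q_def)
  moreover have "Q A = contam_cond_lower \<epsilon> P0 A B"
    by (simp add: Q_def PB contam_cond_lower_def)
  ultimately show thesis by (rule that)
qed

text \<open>The bound is attained, so the infimum is a minimum; this also settles that the set of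
  values is non-empty and bounded below.\<close>

lemma lower_natural_ext_contam:
  assumes "fa_prob \<Omega> P0" "0 < \<epsilon>" "\<epsilon> < 1" "A \<subseteq> \<Omega>" "B \<subseteq> \<Omega>" "0 < P0 (A \<inter> B)" "\<not> B \<subseteq> A"
  shows "lower_natural_ext \<Omega> (contam_lower \<Omega> \<epsilon> P0) A B = contam_cond_lower \<epsilon> P0 A B"
  unfolding lower_natural_ext_def
proof (rule cInf_eq_minimum)
  obtain P Q where "(P, Q) \<in> cond_credal_set \<Omega> (contam_lower \<Omega> \<epsilon> P0) B"
    and "Q A = contam_cond_lower \<epsilon> P0 A B"
    using contam_cond_lower_attained[of \<Omega> P0 \<epsilon> A B] assms by blast
  then show "contam_cond_lower \<epsilon> P0 A B
      \<in> (\<lambda>(P, Q). Q A) ` cond_credal_set \<Omega> (contam_lower \<Omega> \<epsilon> P0) B"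
    by force
qed (use contam_cond_lower_le[OF assms(1-6)] in auto)

text \<open>Each \<open>Q\<close> is additive, so maximising \<open>Q A\<close> amounts to
  minimising \<open>Q (\<Omega> - A)\<close>.\<close>

lemma upper_natural_ext_contam:
  assumes "fa_prob \<Omega> P0" "0 < \<epsilon>" "\<epsilon> < 1" "A \<subseteq> \<Omega>" "B \<subseteq> \<Omega>" "0 < P0 ((\<Omega> - A) \<inter> B)"
    and "\<not> B \<subseteq> \<Omega> - A"
  shows "upper_natural_ext \<Omega> (contam_lower \<Omega> \<epsilon> P0) A B
    = 1 - contam_cond_lower \<epsilon> P0 (\<Omega> - A) B"
  unfolding upper_natural_ext_def
proof (rule cSup_eq_maximum)
  let ?C = "cond_credal_set \<Omega> (contam_lower \<Omega> \<epsilon> P0) B"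
  have conj: "Q A = 1 - Q (\<Omega> - A)" if "(P, Q) \<in> ?C" for P Q
    using that fa_prob_compl[of \<Omega> Q A] assms(4) by (auto simp: cond_credal_set_def)
  obtain P Q where PQ: "(P, Q) \<in> ?C" "Q (\<Omega> - A) = contam_cond_lower \<epsilon> P0 (\<Omega> - A) B"
    using contam_cond_lower_attained[of \<Omega> P0 \<epsilon> "\<Omega> - A" B] assms by blast
  then show "1 - contam_cond_lower \<epsilon> P0 (\<Omega> - A) B \<in> (\<lambda>(P, Q). Q A) ` ?C"
    using conj by force
  show "x \<le> 1 - contam_cond_lower \<epsilon> P0 (\<Omega> - A) B" if "x \<in> (\<lambda>(P, Q). Q A) ` ?C" for x
    using that conj contam_cond_lower_le[OF assms(1-3) Diff_subset assms(5,6)] by fastforce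
qed

text \<open>The positive factor \<open>1 - \<epsilon>\<close> cancels, and the denominator equals
  \<open>P0 B + \<epsilon> * P0 (\<Omega> - B)\<close>; its first term gives the product
  \<open>P0 A * P0 B\<close>, its second the bound on the right.\<close>

lemma contam_cond_lower_le_iff:
  assumes P0: "fa_prob \<Omega> P0" and eps: "0 < \<epsilon>" "\<epsilon> < 1" and B: "B \<subseteq> \<Omega>"
  shows "contam_cond_lower \<epsilon> P0 A B \<le> (1 - \<epsilon>) * P0 A
    \<longleftrightarrow> P0 (A \<inter> B) - P0 A * P0 B \<le> \<epsilon> * P0 A * P0 (\<Omega> - B)"
proof -
  have den: "0 < (1 - \<epsilon>) * P0 B + \<epsilon>"
    using eps fa_prob_nonneg[OF P0 B] by (simp add: add_nonneg_pos)
  have "contam_cond_lower \<epsilon> P0 A B \<le> (1 - \<epsilon>) * P0 A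
      \<longleftrightarrow> (1 - \<epsilon>) * P0 (A \<inter> B) \<le> (1 - \<epsilon>) * (P0 A * ((1 - \<epsilon>) * P0 B + \<epsilon>))"
    using den by (simp add: contam_cond_lower_def divide_le_eq mult.assoc)
  also have "\<dots> \<longleftrightarrow> P0 (A \<inter> B) \<le> P0 A * ((1 - \<epsilon>) * P0 B + \<epsilon>)"
    using eps by simp
  also have "\<dots> \<longleftrightarrow> P0 (A \<inter> B) - P0 A * P0 B \<le> \<epsilon> * P0 A * P0 (\<Omega> - B)"
    by (simp add: fa_prob_compl[OF P0 B] algebra_simps)
  finally show ?thesis .
qed

theorem proposition4p2:
  fixes \<Omega> :: "'w set" and P0 :: "'w set \<Rightarrow> real" and \<epsilon> :: real
    and \<B> :: "'w set set" and A :: "'w set"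
  assumes "fa_prob \<Omega> P0"
    and "0 < \<epsilon>" and "\<epsilon> < 1"
    and "partition_on \<Omega> \<B>"
    and "A \<in> Pow \<Omega>"
    and "\<not> extreme_event (contam_lower \<Omega> \<epsilon> P0) (contam_upper \<epsilon> P0) A"
    and "logically_independent \<Omega> A \<B>"
    and "\<forall>B\<in>\<B>. 0 < P0 (A \<inter> B) \<and> 0 < P0 ((\<Omega> - A) \<inter> B)"
  shows "weakly_dilates \<Omega> (contam_lower \<Omega> \<epsilon> P0) (contam_upper \<epsilon> P0) \<B> A \<longleftrightarrow>
    (\<forall>B\<in>\<B>. - \<epsilon> * P0 (\<Omega> - A) * P0 (\<Omega> - B) \<le> P0 (A \<inter> B) - P0 A * P0 B \<and>
            P0 (A \<inter> B) - P0 A * P0 B \<le> \<epsilon> * P0 A * P0 (\<Omega> - B))"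
proof -
  note P0 = assms(1) and eps = assms(2,3)
  let ?L = "contam_lower \<Omega> \<epsilon> P0" and ?U = "contam_upper \<epsilon> P0"
  have A: "A \<subseteq> \<Omega>" using assms(5) by simp
  have "(lower_natural_ext \<Omega> ?L A B \<le> ?L A \<and> ?L A \<le> ?U A \<and> ?U A \<le> upper_natural_ext \<Omega> ?L A B)
      \<longleftrightarrow> (- \<epsilon> * P0 (\<Omega> - A) * P0 (\<Omega> - B) \<le> P0 (A \<inter> B) - P0 A * P0 B \<and>
           P0 (A \<inter> B) - P0 A * P0 B \<le> \<epsilon> * P0 A * P0 (\<Omega> - B))" if "B \<in> \<B>" for B
  proof -
    have B: "B \<subseteq> \<Omega>" and nsub: "\<not> B \<subseteq> A" "\<not> B \<subseteq> \<Omega> - A"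
      and pos: "0 < P0 (A \<inter> B)" "0 < P0 ((\<Omega> - A) \<inter> B)"
      using that assms(4,7,8) by (auto simp: partition_on_def logically_independent_def)
    \<comment> \<open>Logical independence excludes the two events at which the contamination model
      departs from its linear formula.\<close>
    have "A \<noteq> \<Omega>" "A \<noteq> {}" using B nsub by auto
    then have LU: "?L A = (1 - \<epsilon>) * P0 A" "?U A = (1 - \<epsilon>) * P0 A + \<epsilon>"
      by (simp_all add: contam_lower_def contam_upper_def)
    have compl: "P0 (\<Omega> - A) = 1 - P0 A" by (rule fa_prob_compl[OF P0 A])
    have "(\<Omega> - A) \<inter> B = B - A" using B by blast
    then have "P0 ((\<Omega> - A) \<inter> B) = P0 B - P0 (A \<inter> B)"
      using fa_prob_split[OF P0 B, of A] by simp
    \<comment> \<open>The covariance changes sign when \<open>A\<close> is replaced by its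
      complement, so the criterion applied to \<open>\<Omega> - A\<close> becomes the left-hand
      inequality for \<open>A\<close>.\<close>
    then have cov: "P0 ((\<Omega> - A) \<inter> B) - P0 (\<Omega> - A) * P0 B = - (P0 (A \<inter> B) - P0 A * P0 B)"
      by (simp add: compl algebra_simps)
    \<comment> \<open>Conjugacy of the unconditional model enters here: \<open>?U A\<close> equals
      \<open>1 - (1 - \<epsilon>) * P0 (\<Omega> - A)\<close>.\<close>
    have "?U A \<le> upper_natural_ext \<Omega> ?L A B
        \<longleftrightarrow> contam_cond_lower \<epsilon> P0 (\<Omega> - A) B \<le> (1 - \<epsilon>) * P0 (\<Omega> - A)"
      by (auto simp: upper_natural_ext_contam[OF P0 eps A B pos(2) nsub(2)] LU compl algebra_simps)
    also have "\<dots> \<longleftrightarrow> - \<epsilon> * P0 (\<Omega> - A) * P0 (\<Omega> - B) \<le> P0 (A \<inter> B) - P0 A * P0 B"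
      unfolding contam_cond_lower_le_iff[OF P0 eps B] cov by auto
    \<comment> \<open>The middle inequality \<open>?L A \<le> ?U A\<close> is automatic, as the two
      sides differ by \<open>\<epsilon>\<close>.\<close>
    finally show ?thesis
      using contam_cond_lower_le_iff[OF P0 eps B, of A] eps
      by (auto simp: lower_natural_ext_contam[OF P0 eps A B pos(1) nsub(1)] LU)
  qed
  then show ?thesis by (simp add: weakly_dilates_def)
qed

end
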